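(* For all integers $k$, $t$, $s$ and every positive integer $n$, the following identities hold: \[\sum_{j=0}^n(-1)^{tj}\binom nj F_k^jF_t^{n-j}F_{(s+k)n-(t+k)j}=F_{t+k}^nF_{sn},\] \[\sum_{j=0}^n(-1)^{tj}\binom nj F_k^jF_t^{n-j}L_{(s+k)n-(t+k)j}=F_{t+k}^nL_{sn},\] \[\sum_{j=0}^n(-1)^{j}\binom nj F_{k+t}^jF_t^{n-j}F_{(s+k)n-kj}=(-1)^{n(t+1)}F_k^nF_{n(s-t)},\] \[\sum_{j=0}^n(-1)^{j}\binom nj F_{k+t}^jF_t^{n-j}L_{(s+k)n-kj}=(-1)^{n(t+1)}F_k^nL_{n(s-t)},\] \[\sum_{j=0}^n(-1)^{(t+1)j}\binom nj F_k^jF_{k+t}^{n-j}F_{sn-tj}=F_t^nF_{n(s+k)},\] \[\sum_{j=0}^n(-1)^{(t+1)j}\binom nj F_k^jF_{k+t}^{n-j}L_{sn-tj}=F_t^nL_{n(s+k)},\] \[(-1)^t\sum_{j=1}^n(-1)^{tj}\binom nj\,j\,F_k^{j-1}F_t^{n-j}F_{(k+s)n+t-s-(k+t)j}=nF_{k+t}^{n-1}F_{s(n-1)},\] \[(-1)^t\sum_{j=1}^n(-1)^{tj}\binom nj\,j\,F_k^{j-1}F_t^{n-j}L_{(k+s)n+t-s-(k+t)j}=nF_{k+t}^{n-1}L_{s(n-1)},\] \[\sum_{j=1}^n(-1)^{j}\binom nj\,j\,F_{k+t}^{j-1}F_t^{n-j}F_{(k+s)n-s-kj}=(-1)^{n(t+1)+t}nF_k^{n-1}F_{(s-t)(n-1)},\]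 \[\sum_{j=1}^n(-1)^{j}\binom nj\,j\,F_{k+t}^{j-1}F_t^{n-j}L_{(k+s)n-s-kj}=(-1)^{n(t+1)+t}nF_k^{n-1}L_{(s-t)(n-1)},\] \[(-1)^{t+1}\sum_{j=1}^n(-1)^{(t+1)j}\binom nj\,j\,F_k^{j-1}F_{k+t}^{n-j}F_{s(n-1)+t-tj}=nF_t^{n-1}F_{(s+k)(n-1)},\] \[(-1)^{t+1}\sum_{j=1}^n(-1)^{(t+1)j}\binom nj\,j\,F_k^{j-1}F_{k+t}^{n-j}L_{s(n-1)+t-tj}=nF_t^{n-1}L_{(s+k)(n-1)}.\]
   Context: The Fibonacci numbers $F_n$ and Lucas numbers $L_n$ are defined for all integers $n$ by $F_0=0$, $F_1=1$, $F_n=F_{n-1}+F_{n-2}$ for $n\ge 2$; $L_0=2$, $L_1=1$, $L_n=L_{n-1}+L_{n-2}$ for $n\ge 2$; and $F_{-n}=(-1)^{n-1}F_n$, $L_{-n}=(-1)^nL_n$. Here $F_m^i$ denotes the $i$-th power $(F_m)^i$, with the usual convention $0^0=1$. *)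

theory Defs
  imports Complex_Main "HOL-Number_Theory.Fib"
begin

text \<open>The library's \<^const>\<open>fib\<close> is indexed by \<^typ>\<open>nat\<close>; it is extended to negative indices by
  $F_{-n} = (-1)^{n-1} F_n$.\<close>

definition fib_int :: "int \<Rightarrow> int" where
  "fib_int m = (if m \<ge> 0 then int (fib (nat m))
                else (-1) ^ nat (- m - 1) * int (fib (nat (- m))))"

fun lucas :: "nat \<Rightarrow> nat" where
  "lucas 0 = 2"
| "lucas (Suc 0) = 1"
| "lucas (Suc (Suc n)) = lucas (Suc n) + lucas n"

text \<open>Extension to negative indices by $L_{-n} = (-1)^n L_n$.\<close>

definition lucas_int :: "int \<Rightarrow> int" where
  "lucas_int m = (if m \<ge> 0 then int (lucas (nat m))
                  else (-1) ^ nat (- m) * int (lucas (nat (- m))))"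

text \<open>The identities are stated over \<^typ>\<open>real\<close> only so that signs with a possibly negative integer
  exponent can be written with \<^const>\<open>power_int\<close>, which is not available on \<^typ>\<open>int\<close>.\<close>

end

theory Submission
  imports Defs
begin

text \<open>
  Let \<open>x, y\<close> be the two roots of \<open>X\<^sup>2 = X + 1\<close>, in either order, so that \<open>x + y = 1\<close> and
  \<open>x * y = -1\<close>. Binet's formulas \<open>(x - y) F\<^sub>m = x\<^sup>m - y\<^sup>m\<close> and \<open>L\<^sub>m = x\<^sup>m + y\<^sup>m\<close> hold for all
  integers \<open>m\<close>. Hence an identity that is linear in the terms \<open>F\<^sub>m\<close> (or \<open>L\<^sub>m\<close>) follows as soon as
  it holds with the powers \<open>x\<^sup>m\<close> of each root in their place (lemma \<open>fib_lucas_sum_transfer\<close>).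

  Since \<open>y\<^sup>t = (-1)\<^sup>t x\<^sup>-\<^sup>t\<close>, Binet's formula gives the three-term relation
  \<open>F\<^sub>t x\<^sup>k + (-1)\<^sup>t F\<^sub>k x\<^sup>-\<^sup>t = F\<^sub>t\<^sub>+\<^sub>k\<close> (lemma \<open>fib_three_term\<close>). Each of its terms can be isolated;
  raising the resulting equation to the \<open>n\<close>-th power by the binomial theorem and multiplying by
  \<open>x\<^sup>s\<^sup>n\<close> gives the first three pairs of identities. The three pairs with the weight \<open>j\<close> are,
  up to sign, the same identities for \<open>n - 1\<close> multiplied by \<open>n\<close>, because of the absorption rule
  \<open>j (n choose j) = n (n - 1 choose j - 1)\<close>.
\<close>

section \<open>Binet's formulas for integer indices\<close>

lemma golden_root_power_add_two:
  fixes x y :: real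
  assumes "x + y = 1" "x * y = -1"
  shows "x ^ Suc (Suc n) = x ^ Suc n + x ^ n"
proof -
  have "y = 1 - x"
    using assms(1) by simp
  then have "x * x = x + 1"
    using assms(2) by (simp add: right_diff_distrib)
  then have "(x * x) * x ^ n = (x + 1) * x ^ n"
    by (rule arg_cong)
  then show ?thesis
    by (simp add: distrib_right mult.assoc)
qed

lemma fib_binet_nat:
  fixes x y :: real
  assumes "x + y = 1" "x * y = -1"
  shows "(x - y) * real (fib n) = x ^ n - y ^ n"
proof (induction n rule: fib.induct)
  case (3 n)
  have "y + x = 1" "y * x = -1"
    using assms by (simp_all add: algebra_simps)
  then show ?case
    using 3 golden_root_power_add_two[OF assms, of n] golden_root_power_add_two[of y x n]
    by (simp add: distrib_left del: power_Suc)
qed simp_all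

lemma lucas_binet_nat:
  fixes x y :: real
  assumes "x + y = 1" "x * y = -1"
  shows "real (lucas n) = x ^ n + y ^ n"
proof (induction n rule: lucas.induct)
  case (3 n)
  have "y + x = 1" "y * x = -1"
    using assms by (simp_all add: algebra_simps)
  then show ?case
    using 3 golden_root_power_add_two[OF assms, of n] golden_root_power_add_two[of y x n]
    by (simp del: power_Suc)
qed (use assms in simp_all)

text \<open>Inverting one root gives the other up to sign; this carries Binet's formulas over to negative
  indices.\<close>

lemma golden_root_powi_conj:
  fixes x y :: real
  assumes "x * y = -1"
  shows "y powi m = (-1) powi m * x powi (- m)"
proof -
  have "y = (-1) * inverse x"
    using assms by (cases "x = 0") (auto simp: field_simps)
  then show ?thesis
    by (simp only: power_int_mult_distrib power_int_inverse power_int_minus)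
qed

lemma golden_root_power_inverse:
  fixes x y :: real
  assumes "x * y = -1"
  shows "x powi (- int n) = (-1) ^ n * y ^ n"
  using golden_root_powi_conj[of y x "- int n"] assms
  by (simp add: mult.commute power_int_minus flip: power_inverse)

lemma fib_binet:
  fixes x y :: real
  assumes "x + y = 1" "x * y = -1"
  shows "(x - y) * real_of_int (fib_int m) = x powi m - y powi m"
proof (cases m rule: int_cases)
  case (nonneg n)
  then show ?thesis
    using fib_binet_nat[OF assms, of n] by (simp add: fib_int_def)
next
  case (neg n)
  have "y * x = -1"
    using assms(2) by (simp add: mult.commute)
  then have "x powi m - y powi m = (-1) ^ Suc n * y ^ Suc n - (-1) ^ Suc n * x ^ Suc n"
    unfolding neg by (simp only: golden_root_power_inverse[OF assms(2)] golden_root_power_inverse[of y x])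
  also have "\<dots> = (-1) ^ n * (x ^ Suc n - y ^ Suc n)"
    by (simp add: algebra_simps)
  also have "\<dots> = (x - y) * ((-1) ^ n * real (fib (Suc n)))"
    unfolding fib_binet_nat[OF assms, symmetric] by (simp only: ac_simps)
  also have "(-1) ^ n * real (fib (Suc n)) = real_of_int (fib_int m)"
  proof -
    have "nat (- m) = Suc n" "nat (- m - 1) = n"
      using neg by auto
    then show ?thesis
      using neg by (simp add: fib_int_def del: fib.simps)
  qed
  finally show ?thesis by simp
qed

lemma lucas_binet:
  fixes x y :: real
  assumes "x + y = 1" "x * y = -1"
  shows "real_of_int (lucas_int m) = x powi m + y powi m"
proof (cases m rule: int_cases)
  case (nonneg n)
  then show ?thesis
    using lucas_binet_nat[OF assms, of n] by (simp add: lucas_int_def)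
next
  case (neg n)
  have "y * x = -1"
    using assms(2) by (simp add: mult.commute)
  then have "x powi m + y powi m = (-1) ^ Suc n * y ^ Suc n + (-1) ^ Suc n * x ^ Suc n"
    unfolding neg by (simp only: golden_root_power_inverse[OF assms(2)] golden_root_power_inverse[of y x])
  also have "\<dots> = (-1) ^ Suc n * real (lucas (Suc n))"
    unfolding lucas_binet_nat[OF assms] by (simp only: distrib_left add.commute)
  also have "\<dots> = real_of_int (lucas_int m)"
  proof -
    have "nat (- m) = Suc n"
      using neg by auto
    then show ?thesis
      using neg by (simp add: lucas_int_def del: lucas.simps)
  qed
  finally show ?thesis by simp
qed

text \<open>A linear relation that holds between the powers of each root holds between the Fibonacci
  numbers, and between the Lucas numbers, with the same indices.\<close>

lemma fib_lucas_sum_transfer: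
  fixes w :: "'a \<Rightarrow> real" and e :: "'a \<Rightarrow> int"
  assumes roots: "\<And>x y :: real. x + y = 1 \<Longrightarrow> x * y = -1 \<Longrightarrow>
      (\<Sum>j\<in>A. w j * x powi e j) = v * x powi f"
  shows "(\<Sum>j\<in>A. w j * real_of_int (fib_int (e j))) = v * real_of_int (fib_int f)"
    and "(\<Sum>j\<in>A. w j * real_of_int (lucas_int (e j))) = v * real_of_int (lucas_int f)"
proof -
  \<comment> \<open>The sums for \<open>x\<close> and for \<open>y\<close> are subtracted (Fibonacci) or added (Lucas).\<close>
  define x y :: real where "x = (1 + sqrt 5) / 2" and "y = (1 - sqrt 5) / 2"
  have xy: "x + y = 1" "x * y = -1"
    by (simp_all add: x_def y_def field_simps)
  then have yx: "y + x = 1" "y * x = -1"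
    by (simp_all add: algebra_simps)
  have "x - y \<noteq> 0"
    by (simp add: x_def y_def)
  have "(x - y) * (\<Sum>j\<in>A. w j * real_of_int (fib_int (e j)))
      = (\<Sum>j\<in>A. w j * ((x - y) * real_of_int (fib_int (e j))))"
    by (simp add: sum_distrib_left ac_simps)
  also have "\<dots> = (\<Sum>j\<in>A. w j * x powi e j) - (\<Sum>j\<in>A. w j * y powi e j)"
    by (simp add: fib_binet[OF xy] right_diff_distrib sum_subtractf)
  also have "\<dots> = v * ((x - y) * real_of_int (fib_int f))"
    by (simp add: roots[OF xy] roots[OF yx] fib_binet[OF xy] right_diff_distrib)
  finally show "(\<Sum>j\<in>A. w j * real_of_int (fib_int (e j))) = v * real_of_int (fib_int f)"
    using \<open>x - y \<noteq> 0\<close> by simp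
  show "(\<Sum>j\<in>A. w j * real_of_int (lucas_int (e j))) = v * real_of_int (lucas_int f)"
    by (simp add: lucas_binet[OF xy] distrib_left sum.distrib roots[OF xy] roots[OF yx])
qed

section \<open>Binomial sums of powers of a root\<close>

text \<open>With \<open>y\<^sup>t = (-1)\<^sup>t x\<^sup>-\<^sup>t\<close> the claim reads \<open>F\<^sub>t x\<^sup>k + F\<^sub>k y\<^sup>t = F\<^sub>t\<^sub>+\<^sub>k\<close>. After multiplication by
  \<open>x - y\<close>, Binet's formula turns the left side into a sum whose mixed terms \<open>x\<^sup>k y\<^sup>t\<close> cancel.\<close>

lemma fib_three_term:
  fixes x y :: real
  assumes "x + y = 1" "x * y = -1"
  shows "real_of_int (fib_int t) * x powi k + (-1) powi t * real_of_int (fib_int k) * x powi (- t)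
    = real_of_int (fib_int (t + k))"
proof -
  have "x \<noteq> 0" "y \<noteq> 0"
    using assms(2) by auto
  have "x \<noteq> y"
  proof
    assume "x = y"
    then have "x * x = -1"
      using assms(2) by simp
    then show False
      using zero_le_square[of x] by simp
  qed
  have "(x - y) * (real_of_int (fib_int t) * x powi k + real_of_int (fib_int k) * y powi t)
      = ((x - y) * real_of_int (fib_int t)) * x powi k + ((x - y) * real_of_int (fib_int k)) * y powi t"
    by (simp add: algebra_simps)
  also have "\<dots> = x powi (t + k) - y powi (t + k)"
    unfolding fib_binet[OF assms] using \<open>x \<noteq> 0\<close> \<open>y \<noteq> 0\<close>
    by (simp add: power_int_add algebra_simps)
  also have "\<dots> = (x - y) * real_of_int (fib_int (t + k))"
    by (simp add: fib_binet[OF assms])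
  finally have "real_of_int (fib_int t) * x powi k + real_of_int (fib_int k) * y powi t
      = real_of_int (fib_int (t + k))"
    using \<open>x \<noteq> y\<close> by simp
  then show ?thesis
    by (simp add: golden_root_powi_conj[OF assms(2)] ac_simps)
qed

text \<open>The binomial theorem for the \<open>n\<close>-th power of \<open>a x\<^sup>p + b x\<^sup>q = c x\<^sup>r\<close>, multiplied by
  \<open>x\<^sup>s\<^sup>n\<close>.\<close>

lemma binomial_powi:
  fixes x a b c :: real and p q r s :: int
  assumes "x \<noteq> 0" and "a * x powi p + b * x powi q = c * x powi r"
  shows "(\<Sum>j = 0..n. real (n choose j) * a ^ j * b ^ (n - j)
      * x powi ((s + q) * int n - (q - p) * int j)) = c ^ n * x powi ((s + r) * int n)"
proof -
  have "c ^ n * x powi ((s + r) * int n) = x powi (s * int n) * (c * x powi r) ^ n"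
    using assms(1) by (simp add: power_mult_distrib power_int_add distrib_right power_int_mult)
  also have "\<dots> = x powi (s * int n) * (a * x powi p + b * x powi q) ^ n"
    by (simp only: assms(2))
  also have "\<dots> = (\<Sum>j = 0..n. x powi (s * int n)
      * (real (n choose j) * (a * x powi p) ^ j * (b * x powi q) ^ (n - j)))"
    by (simp only: binomial_ring sum_distrib_left atMost_atLeast0)
  also have "\<dots> = (\<Sum>j = 0..n. real (n choose j) * a ^ j * b ^ (n - j)
      * x powi ((s + q) * int n - (q - p) * int j))"
  proof (rule sum.cong)
    fix j assume "j \<in> {0..n}"
    then have "(s + q) * int n - (q - p) * int j = s * int n + p * int j + q * int (n - j)"
      by (simp add: of_nat_diff algebra_simps)
    then have "x powi ((s + q) * int n - (q - p) * int j)
        = x powi (s * int n) * (x powi p) ^ j * (x powi q) ^ (n - j)"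
      using assms(1) by (simp add: power_int_add power_int_mult)
    then show "x powi (s * int n)
          * (real (n choose j) * (a * x powi p) ^ j * (b * x powi q) ^ (n - j))
        = real (n choose j) * a ^ j * b ^ (n - j) * x powi ((s + q) * int n - (q - p) * int j)"
      by (simp only: power_mult_distrib ac_simps)
  qed simp
  finally show ?thesis by simp
qed

text \<open>A relation between three powers of each root thus gives binomial sums of Fibonacci and Lucas
  numbers. It is used with the three rearrangements of \<open>fib_three_term\<close>.\<close>

lemma binomial_fib_lucas:
  fixes a b c :: real and p q r s :: int
  assumes "\<forall>x y :: real. x + y = 1 \<longrightarrow> x * y = -1 \<longrightarrow>
      a * x powi p + b * x powi q = c * x powi r"
  shows "(\<Sum>j = 0..n. real (n choose j) * a ^ j * b ^ (n - j)
        * real_of_int (fib_int ((s + q) * int n - (q - p) * int j)))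
      = c ^ n * real_of_int (fib_int ((s + r) * int n))"
    and "(\<Sum>j = 0..n. real (n choose j) * a ^ j * b ^ (n - j)
        * real_of_int (lucas_int ((s + q) * int n - (q - p) * int j)))
      = c ^ n * real_of_int (lucas_int ((s + r) * int n))"
proof -
  have roots: "(\<Sum>j = 0..n. (real (n choose j) * a ^ j * b ^ (n - j))
        * x powi ((s + q) * int n - (q - p) * int j)) = c ^ n * x powi ((s + r) * int n)"
    if "x + y = 1" "x * y = -1" for x y :: real
    using that assms by (intro binomial_powi) auto
  show "(\<Sum>j = 0..n. real (n choose j) * a ^ j * b ^ (n - j)
        * real_of_int (fib_int ((s + q) * int n - (q - p) * int j)))
      = c ^ n * real_of_int (fib_int ((s + r) * int n))"
    by (rule fib_lucas_sum_transfer(1)[OF roots])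
  show "(\<Sum>j = 0..n. real (n choose j) * a ^ j * b ^ (n - j)
        * real_of_int (lucas_int ((s + q) * int n - (q - p) * int j)))
      = c ^ n * real_of_int (lucas_int ((s + r) * int n))"
    by (rule fib_lucas_sum_transfer(2)[OF roots])
qed

section \<open>The three pairs of unweighted identities\<close>

lemma minus_one_powi_mult_nat: "(-1 :: real) powi (t * int j) = ((-1) powi t) ^ j"
  by (simp add: power_int_mult)

lemma binomial_fib_lucas_sum_add:
  fixes k t s :: int
  shows "(\<Sum>j = 0..n. (-1) powi (t * int j) * real (n choose j)
        * real_of_int (fib_int k) ^ j * real_of_int (fib_int t) ^ (n - j)
        * real_of_int (fib_int ((s + k) * int n - (t + k) * int j)))
      = real_of_int (fib_int (t + k)) ^ n * real_of_int (fib_int (s * int n))" (is ?fib)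
    and "(\<Sum>j = 0..n. (-1) powi (t * int j) * real (n choose j)
        * real_of_int (fib_int k) ^ j * real_of_int (fib_int t) ^ (n - j)
        * real_of_int (lucas_int ((s + k) * int n - (t + k) * int j)))
      = real_of_int (fib_int (t + k)) ^ n * real_of_int (lucas_int (s * int n))" (is ?lucas)
proof -
  have "\<forall>x y :: real. x + y = 1 \<longrightarrow> x * y = -1 \<longrightarrow>
      ((-1) powi t * real_of_int (fib_int k)) * x powi (- t) + real_of_int (fib_int t) * x powi k
      = real_of_int (fib_int (t + k)) * x powi 0"
    by (intro allI impI, drule (1) fib_three_term[where t = t and k = k])
      simp
  note sums = binomial_fib_lucas[OF this, where n = n and s = s]
  show ?fib ?lucas
    unfolding minus_one_powi_mult_nat using sums by (simp_all add: power_mult_distrib ac_simps)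
qed

lemma binomial_fib_lucas_sum_alternating:
  fixes k t s :: int
  shows "(\<Sum>j = 0..n. (-1) ^ j * real (n choose j)
        * real_of_int (fib_int (k + t)) ^ j * real_of_int (fib_int t) ^ (n - j)
        * real_of_int (fib_int ((s + k) * int n - k * int j)))
      = (-1) powi (int n * (t + 1)) * real_of_int (fib_int k) ^ n
        * real_of_int (fib_int (int n * (s - t)))" (is ?fib)
    and "(\<Sum>j = 0..n. (-1) ^ j * real (n choose j)
        * real_of_int (fib_int (k + t)) ^ j * real_of_int (fib_int t) ^ (n - j)
        * real_of_int (lucas_int ((s + k) * int n - k * int j)))
      = (-1) powi (int n * (t + 1)) * real_of_int (fib_int k) ^ n
        * real_of_int (lucas_int (int n * (s - t)))" (is ?lucas)
proof -
  have "\<forall>x y :: real. x + y = 1 \<longrightarrow> x * y = -1 \<longrightarrow>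
      (-1 * real_of_int (fib_int (k + t))) * x powi 0 + real_of_int (fib_int t) * x powi k
      = ((-1) powi (t + 1) * real_of_int (fib_int k)) * x powi (- t)"
    by (intro allI impI, drule (1) fib_three_term[where t = t and k = k])
      (simp add: power_int_add add.commute)
  note sums = binomial_fib_lucas[OF this, where n = n and s = s]
  have sign: "(-1 :: real) powi (int n * (t + 1)) = ((-1) powi (t + 1)) ^ n"
    by (simp only: minus_one_powi_mult_nat mult.commute[of "int n"])
  show ?fib ?lucas
    unfolding sign using sums by (simp_all only: power_mult_distrib ac_simps diff_conv_add_uminus
        minus_zero add_0_right add_0_left)
qed

lemma binomial_fib_lucas_sum_diff:
  fixes k t s :: int
  shows "(\<Sum>j = 0..n. (-1) powi ((t + 1) * int j) * real (n choose j)
        * real_of_int (fib_int k) ^ j * real_of_int (fib_int (k + t)) ^ (n - j)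
        * real_of_int (fib_int (s * int n - t * int j)))
      = real_of_int (fib_int t) ^ n * real_of_int (fib_int (int n * (s + k)))" (is ?fib)
    and "(\<Sum>j = 0..n. (-1) powi ((t + 1) * int j) * real (n choose j)
        * real_of_int (fib_int k) ^ j * real_of_int (fib_int (k + t)) ^ (n - j)
        * real_of_int (lucas_int (s * int n - t * int j)))
      = real_of_int (fib_int t) ^ n * real_of_int (lucas_int (int n * (s + k)))" (is ?lucas)
proof -
  have "\<forall>x y :: real. x + y = 1 \<longrightarrow> x * y = -1 \<longrightarrow>
      ((-1) powi (t + 1) * real_of_int (fib_int k)) * x powi (- t)
        + real_of_int (fib_int (k + t)) * x powi 0
      = real_of_int (fib_int t) * x powi k"
    by (intro allI impI, drule (1) fib_three_term[where t = t and k = k])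
      (simp add: power_int_add add.commute)
  note sums = binomial_fib_lucas[OF this, where n = n and s = s]
  show ?fib ?lucas
    unfolding minus_one_powi_mult_nat using sums by (simp_all add: power_mult_distrib ac_simps)
qed

section \<open>The three pairs of weighted identities\<close>

text \<open>The absorption rule \<open>j (n choose j) = n (n - 1 choose j - 1)\<close> inside a sum. In the
  applications \<open>u\<close> is the sequence of signs \<open>c\<^sup>j\<close>, so the index shift costs one sign \<open>c\<close>.\<close>

lemma sum_binomial_absorb:
  fixes u g :: "nat \<Rightarrow> real" and a b c :: real
  assumes "n > 0" and "\<And>i. u (Suc i) = c * u i"
  shows "(\<Sum>j = 1..n. u j * real (n choose j) * real j * a ^ (j - 1) * b ^ (n - j) * g j)
    = c * (real n * (\<Sum>i = 0..n - 1. u i * real (n - 1 choose i) * a ^ i * b ^ (n - 1 - i)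
        * g (Suc i)))"
proof -
  obtain m where n: "n = Suc m"
    using assms(1) gr0_implies_Suc by blast
  have absorb: "real (Suc m choose Suc i) * real (Suc i) = real (Suc m) * real (m choose i)" for i
    by (metis Suc_times_binomial_eq mult.commute of_nat_mult)
  have "(\<Sum>j = 1..n. u j * real (n choose j) * real j * a ^ (j - 1) * b ^ (n - j) * g j)
      = (\<Sum>i = 0..m. u (Suc i) * (real (Suc m choose Suc i) * real (Suc i)) * a ^ i * b ^ (m - i)
          * g (Suc i))"
    unfolding n One_nat_def sum.shift_bounds_cl_Suc_ivl
    by (simp only: mult.assoc diff_Suc_Suc diff_zero)
  also have "\<dots> = c * (real n * (\<Sum>i = 0..m. u i * real (m choose i) * a ^ i * b ^ (m - i)
      * g (Suc i)))"
    unfolding absorb assms(2) n sum_distrib_left by (simp only: ac_simps)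
  finally show ?thesis
    by (simp add: n)
qed

lemma minus_one_powi_mult_Suc:
  "(-1 :: real) powi (t * int (Suc i)) = (-1) powi t * (-1) powi (t * int i)"
  by (simp add: power_int_add distrib_left)

lemma minus_one_powi_mult_self: "(-1 :: real) powi t * ((-1) powi t * z) = z"
  by (simp add: power_int_minus_one_mult_self flip: mult.assoc)

lemma weighted_binomial_fib_lucas_sum_add:
  fixes k t s :: int
  assumes "n > 0"
  shows "(-1) powi t * (\<Sum>j = 1..n. (-1) powi (t * int j) * real (n choose j) * real j
        * real_of_int (fib_int k) ^ (j - 1) * real_of_int (fib_int t) ^ (n - j)
        * real_of_int (fib_int ((k + s) * int n + t - s - (k + t) * int j)))
      = real n * real_of_int (fib_int (k + t)) ^ (n - 1)
        * real_of_int (fib_int (s * (int n - 1)))" (is ?fib)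
    and "(-1) powi t * (\<Sum>j = 1..n. (-1) powi (t * int j) * real (n choose j) * real j
        * real_of_int (fib_int k) ^ (j - 1) * real_of_int (fib_int t) ^ (n - j)
        * real_of_int (lucas_int ((k + s) * int n + t - s - (k + t) * int j)))
      = real n * real_of_int (fib_int (k + t)) ^ (n - 1)
        * real_of_int (lucas_int (s * (int n - 1)))" (is ?lucas)
proof -
  have index: "(k + s) * int n + t - s - (t + k) * int (Suc i)
      = (s + k) * int (n - 1) - (t + k) * int i" for i
    using assms by (simp add: of_nat_diff algebra_simps)
  have pred: "int n - 1 = int (n - 1)"
    using assms by simp
  note absorb = sum_binomial_absorb[where u = "\<lambda>j. (-1) powi (t * int j)",
      OF assms minus_one_powi_mult_Suc]
  show ?fib ?lucas
    by (simp_all only: absorb index pred minus_one_powi_mult_self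
        binomial_fib_lucas_sum_add add.commute[of k t] mult.assoc[of "real n"])
qed

lemma weighted_binomial_fib_lucas_sum_alternating:
  fixes k t s :: int
  assumes "n > 0"
  shows "(\<Sum>j = 1..n. (-1) ^ j * real (n choose j) * real j
        * real_of_int (fib_int (k + t)) ^ (j - 1) * real_of_int (fib_int t) ^ (n - j)
        * real_of_int (fib_int ((k + s) * int n - s - k * int j)))
      = (-1) powi (int n * (t + 1) + t) * real n * real_of_int (fib_int k) ^ (n - 1)
        * real_of_int (fib_int ((s - t) * (int n - 1)))" (is ?fib)
    and "(\<Sum>j = 1..n. (-1) ^ j * real (n choose j) * real j
        * real_of_int (fib_int (k + t)) ^ (j - 1) * real_of_int (fib_int t) ^ (n - j)
        * real_of_int (lucas_int ((k + s) * int n - s - k * int j)))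
      = (-1) powi (int n * (t + 1) + t) * real n * real_of_int (fib_int k) ^ (n - 1)
        * real_of_int (lucas_int ((s - t) * (int n - 1)))" (is ?lucas)
proof -
  have index: "(k + s) * int n - s - k * int (Suc i) = (s + k) * int (n - 1) - k * int i" for i
    using assms by (simp add: of_nat_diff algebra_simps)
  have pred: "(s - t) * (int n - 1) = int (n - 1) * (s - t)"
    using assms by simp
  have sign: "(-1 :: real) powi (int n * (t + 1) + t) = -1 * (-1) powi (int (n - 1) * (t + 1))"
  proof -
    have "int n * (t + 1) + t = 2 * t + 1 + int (n - 1) * (t + 1)"
      using assms by (simp add: of_nat_diff algebra_simps)
    \<comment> \<open>The even part \<open>2 * t\<close> of the exponent does not contribute.\<close>
    then show ?thesis
      by (simp add: power_int_add power_int_mult)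
  qed
  note absorb = sum_binomial_absorb[where u = "\<lambda>j. (-1) ^ j", OF assms power_Suc]
  show ?fib ?lucas
    unfolding absorb index pred sign binomial_fib_lucas_sum_alternating
    by (simp_all only: ac_simps)
qed

lemma weighted_binomial_fib_lucas_sum_diff:
  fixes k t s :: int
  assumes "n > 0"
  shows "(-1) powi (t + 1) * (\<Sum>j = 1..n. (-1) powi ((t + 1) * int j) * real (n choose j) * real j
        * real_of_int (fib_int k) ^ (j - 1) * real_of_int (fib_int (k + t)) ^ (n - j)
        * real_of_int (fib_int (s * (int n - 1) + t - t * int j)))
      = real n * real_of_int (fib_int t) ^ (n - 1)
        * real_of_int (fib_int ((s + k) * (int n - 1)))" (is ?fib)
    and "(-1) powi (t + 1) * (\<Sum>j = 1..n. (-1) powi ((t + 1) * int j) * real (n choose j) * real j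
        * real_of_int (fib_int k) ^ (j - 1) * real_of_int (fib_int (k + t)) ^ (n - j)
        * real_of_int (lucas_int (s * (int n - 1) + t - t * int j)))
      = real n * real_of_int (fib_int t) ^ (n - 1)
        * real_of_int (lucas_int ((s + k) * (int n - 1)))" (is ?lucas)
proof -
  have index: "s * (int n - 1) + t - t * int (Suc i) = s * int (n - 1) - t * int i" for i
    using assms by (simp add: of_nat_diff algebra_simps)
  have pred: "(s + k) * (int n - 1) = int (n - 1) * (s + k)"
    using assms by simp
  note absorb = sum_binomial_absorb[where u = "\<lambda>j. (-1) powi ((t + 1) * int j)",
      OF assms minus_one_powi_mult_Suc]
  show ?fib ?lucas
    by (simp_all only: absorb index pred minus_one_powi_mult_self
        binomial_fib_lucas_sum_diff mult.assoc[of "real n"])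
qed

section \<open>The twelve identities\<close>

theorem theorem3:
  fixes k t s :: int and n :: nat
  assumes "n > 0"
  shows "((\<Sum>j = 0..n. (-1) powi (t * int j) * real (n choose j)
           * real_of_int (fib_int k) ^ j * real_of_int (fib_int t) ^ (n - j)
           * real_of_int (fib_int ((s + k) * int n - (t + k) * int j)))
         = real_of_int (fib_int (t + k)) ^ n * real_of_int (fib_int (s * int n)))
    \<and> ((\<Sum>j = 0..n. (-1) powi (t * int j) * real (n choose j)
           * real_of_int (fib_int k) ^ j * real_of_int (fib_int t) ^ (n - j)
           * real_of_int (lucas_int ((s + k) * int n - (t + k) * int j)))
         = real_of_int (fib_int (t + k)) ^ n * real_of_int (lucas_int (s * int n)))
    \<and> ((\<Sum>j = 0..n. (-1) ^ j * real (n choose j)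
           * real_of_int (fib_int (k + t)) ^ j * real_of_int (fib_int t) ^ (n - j)
           * real_of_int (fib_int ((s + k) * int n - k * int j)))
         = (-1) powi (int n * (t + 1)) * real_of_int (fib_int k) ^ n * real_of_int (fib_int (int n * (s - t))))
    \<and> ((\<Sum>j = 0..n. (-1) ^ j * real (n choose j)
           * real_of_int (fib_int (k + t)) ^ j * real_of_int (fib_int t) ^ (n - j)
           * real_of_int (lucas_int ((s + k) * int n - k * int j)))
         = (-1) powi (int n * (t + 1)) * real_of_int (fib_int k) ^ n * real_of_int (lucas_int (int n * (s - t))))
    \<and> ((\<Sum>j = 0..n. (-1) powi ((t + 1) * int j) * real (n choose j)
           * real_of_int (fib_int k) ^ j * real_of_int (fib_int (k + t)) ^ (n - j)
           * real_of_int (fib_int (s * int n - t * int j)))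
         = real_of_int (fib_int t) ^ n * real_of_int (fib_int (int n * (s + k))))
    \<and> ((\<Sum>j = 0..n. (-1) powi ((t + 1) * int j) * real (n choose j)
           * real_of_int (fib_int k) ^ j * real_of_int (fib_int (k + t)) ^ (n - j)
           * real_of_int (lucas_int (s * int n - t * int j)))
         = real_of_int (fib_int t) ^ n * real_of_int (lucas_int (int n * (s + k))))
    \<and> ((-1) powi t * (\<Sum>j = 1..n. (-1) powi (t * int j) * real (n choose j) * real j
           * real_of_int (fib_int k) ^ (j - 1) * real_of_int (fib_int t) ^ (n - j)
           * real_of_int (fib_int ((k + s) * int n + t - s - (k + t) * int j)))
         = real n * real_of_int (fib_int (k + t)) ^ (n - 1) * real_of_int (fib_int (s * (int n - 1))))
    \<and> ((-1) powi t * (\<Sum>j = 1..n. (-1) powi (t * int j) * real (n choose j) * real j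
           * real_of_int (fib_int k) ^ (j - 1) * real_of_int (fib_int t) ^ (n - j)
           * real_of_int (lucas_int ((k + s) * int n + t - s - (k + t) * int j)))
         = real n * real_of_int (fib_int (k + t)) ^ (n - 1) * real_of_int (lucas_int (s * (int n - 1))))
    \<and> ((\<Sum>j = 1..n. (-1) ^ j * real (n choose j) * real j
           * real_of_int (fib_int (k + t)) ^ (j - 1) * real_of_int (fib_int t) ^ (n - j)
           * real_of_int (fib_int ((k + s) * int n - s - k * int j)))
         = (-1) powi (int n * (t + 1) + t) * real n * real_of_int (fib_int k) ^ (n - 1) * real_of_int (fib_int ((s - t) * (int n - 1))))
    \<and> ((\<Sum>j = 1..n. (-1) ^ j * real (n choose j) * real j
           * real_of_int (fib_int (k + t)) ^ (j - 1) * real_of_int (fib_int t) ^ (n - j)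
           * real_of_int (lucas_int ((k + s) * int n - s - k * int j)))
         = (-1) powi (int n * (t + 1) + t) * real n * real_of_int (fib_int k) ^ (n - 1) * real_of_int (lucas_int ((s - t) * (int n - 1))))
    \<and> ((-1) powi (t + 1) * (\<Sum>j = 1..n. (-1) powi ((t + 1) * int j) * real (n choose j) * real j
           * real_of_int (fib_int k) ^ (j - 1) * real_of_int (fib_int (k + t)) ^ (n - j)
           * real_of_int (fib_int (s * (int n - 1) + t - t * int j)))
         = real n * real_of_int (fib_int t) ^ (n - 1) * real_of_int (fib_int ((s + k) * (int n - 1))))
    \<and> ((-1) powi (t + 1) * (\<Sum>j = 1..n. (-1) powi ((t + 1) * int j) * real (n choose j) * real j
           * real_of_int (fib_int k) ^ (j - 1) * real_of_int (fib_int (k + t)) ^ (n - j)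
           * real_of_int (lucas_int (s * (int n - 1) + t - t * int j)))
         = real n * real_of_int (fib_int t) ^ (n - 1) * real_of_int (lucas_int ((s + k) * (int n - 1))))"
  by (intro conjI binomial_fib_lucas_sum_add binomial_fib_lucas_sum_alternating
      binomial_fib_lucas_sum_diff weighted_binomial_fib_lucas_sum_add[OF assms]
      weighted_binomial_fib_lucas_sum_alternating[OF assms]
      weighted_binomial_fib_lucas_sum_diff[OF assms])

end
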